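(* For any function $f:\mathcal X\times\mathcal Y\to\mathcal Z$ with $k=\lceil\log|\mathcal Z|\rceil$ and error $0<\epsilon<\frac12$, letting $R=R^{\mathrm{oot},\mathrm{priv}}_\epsilon(f)$: if $\epsilon<\frac13$ then $$D^{\mathrm{oot}}(f)\le 2^{R+1}\left(R+\log\left(\frac4{\frac13-\epsilon}\right)+1\right),$$ and for any $\epsilon<\frac12$, $$D^{\mathrm{oot}}(f)\le\left(2^{R+1}+2\right)\left(R+\log\left(\frac8{\frac12-\epsilon}\right)+1\right)+\log(k)+4.$$
   Context: Two-party communication: Alice receives $x$, Bob $y$; a transcript $t_\pi$ is the sequence of exchanged bits; cost is the maximum number of bits exchanged. One-out-of-two model with error $\epsilon$: there are output maps for Alice (depending on $t_\pi$, her randomness and $x$) and Bob (depending on $t_\pi$, his randomness and $y$) with values in $\mathcal Z\cup\{\top\}$ ($\top\notin\mathcal Z$) such that for every $(x,y)$ the pair of outputs lies in $\{(f(x,y),\top),(\top,f(x,y))\}$ with probability at least $1-\epsilon$. $R^{\mathrm{oot},\mathrm{priv}}_\epsilon(f)$ is the minimum cost of such a protocol using only private randomness; $D^{\mathrm{oot}}(f)$ is the minimum cost of a deterministic zero-error protocol in this model. Logarithms are base 2. *)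

theory Defs
  imports "HOL-Probability.Probability" "HOL-Library.Extended_Nat" "HOL-Library.Extended_Real"
begin

text \<open>
  Two-party protocol trees. \<open>'a\<close> is everything Alice holds and \<open>'b\<close> everything Bob holds: just the
  input for a deterministic protocol, the input together with the private random string for a
  randomized one. The first subtree is followed when the bit sent is \<open>False\<close>.
\<close>

datatype ('a, 'b) protocol =
    Stop
  | Alice "'a \<Rightarrow> bool" "('a, 'b) protocol" "('a, 'b) protocol"
  | Bob "'b \<Rightarrow> bool" "('a, 'b) protocol" "('a, 'b) protocol"

fun transcript :: "('a, 'b) protocol \<Rightarrow> 'a \<Rightarrow> 'b \<Rightarrow> bool list" where
  "transcript Stop a b = []"
| "transcript (Alice p t0 t1) a b = p a # transcript (if p a then t1 else t0) a b"
| "transcript (Bob q t0 t1) a b = q b # transcript (if q b then t1 else t0) a b"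

text \<open>The maximum is over a set bounded by the height of the tree, hence finite.\<close>

definition cost :: "'a set \<Rightarrow> 'b set \<Rightarrow> ('a, 'b) protocol \<Rightarrow> nat" where
  "cost A B \<pi> = Max {length (transcript \<pi> a b) | a b. a \<in> A \<and> b \<in> B}"

text \<open>The symbol \<open>\<top>\<close> of the output alphabet is \<open>None\<close>.\<close>

definition oot_correct :: "'z \<Rightarrow> ('z option \<times> 'z option) set" where
  "oot_correct z = {(Some z, None), (None, Some z)}"

definition det_oot_protocol ::
  "('x, 'y) protocol \<Rightarrow> (bool list \<Rightarrow> 'x \<Rightarrow> 'z option) \<Rightarrow> (bool list \<Rightarrow> 'y \<Rightarrow> 'z option) \<Rightarrow>
   ('x \<Rightarrow> 'y \<Rightarrow> 'z) \<Rightarrow> bool" where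
  "det_oot_protocol \<pi> outA outB f \<longleftrightarrow>
     (\<forall>x y. (outA (transcript \<pi> x y) x, outB (transcript \<pi> x y) y) \<in> oot_correct (f x y))"

text \<open>
  The private random strings are independent and drawn from arbitrary discrete distributions
  \<open>\<mu>\<close> and \<open>\<nu>\<close>. Sampling from \<open>nat\<close> loses nothing: for a fixed input a player's behaviour in a
  protocol of bounded cost with finitely many outputs takes finitely many values, and a single
  distribution on \<open>nat\<close> with slowly decaying weights can be partitioned into parts of any finite
  list of prescribed masses.
\<close>

definition priv_oot_protocol ::
  "real \<Rightarrow> nat pmf \<Rightarrow> nat pmf \<Rightarrow> ('x \<times> nat, 'y \<times> nat) protocol \<Rightarrow>
   (bool list \<Rightarrow> nat \<Rightarrow> 'x \<Rightarrow> 'z option) \<Rightarrow> (bool list \<Rightarrow> nat \<Rightarrow> 'y \<Rightarrow> 'z option) \<Rightarrow>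
   ('x \<Rightarrow> 'y \<Rightarrow> 'z) \<Rightarrow> bool" where
  "priv_oot_protocol \<epsilon> \<mu> \<nu> \<pi> outA outB f \<longleftrightarrow>
     (\<forall>x y. measure_pmf.prob (pair_pmf \<mu> \<nu>)
        {(r, s). (outA (transcript \<pi> (x, r) (y, s)) r x, outB (transcript \<pi> (x, r) (y, s)) s y)
                   \<in> oot_correct (f x y)}
        \<ge> 1 - \<epsilon>)"

text \<open>
  Both complexities are \<open>\<infinity>\<close> if there is no protocol at all, which is possible only when both
  input types are infinite; otherwise the infimum is a minimum.
\<close>

definition D_oot :: "('x \<Rightarrow> 'y \<Rightarrow> 'z) \<Rightarrow> enat" where
  "D_oot f = Inf {enat (cost UNIV UNIV \<pi>) | \<pi> outA outB. det_oot_protocol \<pi> outA outB f}"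

definition R_oot_priv :: "real \<Rightarrow> ('x \<Rightarrow> 'y \<Rightarrow> 'z) \<Rightarrow> enat" where
  "R_oot_priv \<epsilon> f =
     Inf {enat (cost (UNIV \<times> set_pmf \<mu>) (UNIV \<times> set_pmf \<nu>) \<pi>) | \<mu> \<nu> \<pi> outA outB.
            priv_oot_protocol \<epsilon> \<mu> \<nu> \<pi> outA outB f}"

lemma finite_transcript_lengths:
  "finite {length (transcript \<pi> a b) | a b. a \<in> A \<and> b \<in> B}"
proof -
  have "length (transcript \<pi> a b) \<le> size \<pi>" for a b
    by (induction \<pi>) auto
  then show ?thesis
    by - (rule finite_subset[of _ "{..size \<pi>}"], auto)
qed

lemma ex_announce:
  "\<exists>\<pi> :: ('a, 'b) protocol. \<forall>a b. transcript \<pi> a b = map (\<lambda>p. p a) ps"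
proof (induction ps)
  case Nil
  show ?case by (intro exI[of _ Stop]) simp
next
  case (Cons p ps)
  then obtain \<pi> :: "('a, 'b) protocol" where "\<forall>a b. transcript \<pi> a b = map (\<lambda>p. p a) ps" by blast
  then show ?case by (intro exI[of _ "Alice p \<pi> \<pi>"]) simp
qed

lemma ex_announce_input:
  fixes g :: "'a \<Rightarrow> 'x::finite"
  shows "\<exists>(\<pi> :: ('a, 'b) protocol) h. \<forall>a b. h (transcript \<pi> a b) = g a"
proof -
  obtain xs :: "'x list" where xs: "set xs = UNIV" using finite_list[OF finite_class.finite_UNIV] by blast
  let ?ps = "map (\<lambda>x a. g a = x) xs"
  obtain \<pi> :: "('a, 'b) protocol" where "\<forall>a b. transcript \<pi> a b = map (\<lambda>p. p a) ?ps"
    using ex_announce[of ?ps] by (rule exE)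
  then have \<pi>: "transcript \<pi> a b = map (\<lambda>x. g a = x) xs" for a b
    by (simp add: comp_def)
  define h where "h \<tau> = (THE x. map (\<lambda>x'. x = x') xs = \<tau>)" for \<tau>
  have "h (transcript \<pi> a b) = g a" for a b
    unfolding h_def \<pi>
  proof (rule the_equality)
    fix x assume "map (\<lambda>x'. x = x') xs = map (\<lambda>x'. g a = x') xs"
    then have "\<forall>x'\<in>set xs. (x = x') = (g a = x')" by (simp only: map_eq_conv)
    then have "(x = x) = (g a = x)" unfolding xs by (rule bspec) (rule UNIV_I)
    then show "x = g a" by simp
  qed (rule refl)
  then have "\<forall>a b. h (transcript \<pi> a b) = g a" by blast
  then show ?thesis by blast
qed

lemma D_oot_finite:
  fixes f :: "'x::finite \<Rightarrow> 'y \<Rightarrow> 'z"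
  shows "D_oot f < \<infinity>"
proof -
  obtain \<pi> :: "('x, 'y) protocol" and h where "\<forall>x y. h (transcript \<pi> x y) = x"
    using ex_announce_input[of "\<lambda>x. x"] by (elim exE)
  then have h: "h (transcript \<pi> x y) = x" for x y by blast
  have "det_oot_protocol \<pi> (\<lambda>_ _. None) (\<lambda>\<tau> y. Some (f (h \<tau>) y)) f"
    by (simp add: det_oot_protocol_def oot_correct_def h)
  then have "D_oot f \<le> enat (cost UNIV UNIV \<pi>)"
    unfolding D_oot_def by (intro Inf_lower) blast
  then show ?thesis by (rule order.strict_trans1) simp
qed

lemma R_oot_priv_finite:
  fixes f :: "'x::finite \<Rightarrow> 'y \<Rightarrow> 'z"
  assumes "0 \<le> \<epsilon>"
  shows "R_oot_priv \<epsilon> f < \<infinity>"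
proof -
  obtain \<pi> :: "('x \<times> nat, 'y \<times> nat) protocol" and h
    where "\<forall>a b. h (transcript \<pi> a b) = fst a"
    using ex_announce_input[of fst] by (elim exE)
  then have h: "h (transcript \<pi> a b) = fst a" for a b by blast
  let ?\<mu> = "return_pmf (0::nat)"
  have "priv_oot_protocol \<epsilon> ?\<mu> ?\<mu> \<pi> (\<lambda>_ _ _. None) (\<lambda>\<tau> _ y. Some (f (h \<tau>) y)) f"
    using assms by (simp add: priv_oot_protocol_def oot_correct_def h)
  then have "R_oot_priv \<epsilon> f \<le> enat (cost (UNIV \<times> set_pmf ?\<mu>) (UNIV \<times> set_pmf ?\<mu>) \<pi>)"
    unfolding R_oot_priv_def by (intro Inf_lower) blast
  then show ?thesis by (rule order.strict_trans1) simp
qed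

end

theory Submission
  imports Defs
begin

text \<open>
  A private-coin protocol of cost \<open>R\<close> has at most \<open>2 ^ R\<close> reachable transcripts \<open>t\<close>, and since the
  coins are independent, the event that \<open>t\<close> occurs and the outputs are \<open>(v, w)\<close> has probability
  \<open>p x t v * q y t w\<close>. The players announce \<open>p x t \<top>\<close> and \<open>q y t \<top>\<close> for all \<open>t\<close>, rounded down to
  \<open>m\<close> bits. Then Alice can compute, up to a small error, the probability \<open>A x z\<close> that she is the
  one to output \<open>z\<close>, and Bob likewise \<open>B y z\<close>; the sum over all \<open>z\<close> of both is at most \<open>1\<close>.

  If \<open>\<epsilon> < 1/3\<close>, then \<open>A x z\<close> or \<open>B y z\<close> exceeds \<open>1/3\<close> for the correct \<open>z\<close>, and neither does for a
  wrong \<open>z\<close>, so one more bit says who answers.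

  If \<open>\<epsilon> < 1/2\<close>, Alice announces \<open>max A\<close>. The correct value is a candidate of Bob, meaning
  \<open>B y z \<ge> 1/2 - max A\<close>, and a candidate of Alice, meaning \<open>A x z \<ge> 1/2 - max B\<close>. If both had three
  candidates, the total weight would be at least
  \<open>max A + 2 (1/2 - max B) + max B + 2 (1/2 - max A) \<ge> 1\<close>, and strictly more with the slack left by
  \<open>\<epsilon> < 1/2\<close>. So one player has at most two candidates; this player announces a position where
  their binary codes differ, and the other one announces the weight of the values having the bit
  \<open>1\<close> there, which decides that bit of the correct value by majority.
\<close>

section \<open>Deterministic protocols on rectangles of inputs\<close>

text \<open>
  Complexity relative to a rectangle of inputs: it can be bounded message by message, each message
  cutting the rectangle down, without mentioning transcripts.
\<close>

definition oot_solvable :: "'x set \<Rightarrow> 'y set \<Rightarrow> nat \<Rightarrow> ('x \<Rightarrow> 'y \<Rightarrow> 'z) \<Rightarrow> bool" where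
  "oot_solvable X Y n f \<longleftrightarrow>
     (\<exists>\<pi> outA outB. \<forall>x\<in>X. \<forall>y\<in>Y. length (transcript \<pi> x y) \<le> n \<and>
        (outA (transcript \<pi> x y) x, outB (transcript \<pi> x y) y) \<in> oot_correct (f x y))"

lemma D_oot_le:
  assumes "oot_solvable UNIV UNIV n f"
  shows "D_oot f \<le> enat n"
proof -
  obtain \<pi> outA outB where *: "\<And>x y. length (transcript \<pi> x y) \<le> n"
      "\<And>x y. (outA (transcript \<pi> x y) x, outB (transcript \<pi> x y) y) \<in> oot_correct (f x y)"
    using assms unfolding oot_solvable_def by blast
  have "D_oot f \<le> enat (cost UNIV UNIV \<pi>)"
    unfolding D_oot_def det_oot_protocol_def using *(2) by (intro Inf_lower) blast
  also have "cost UNIV UNIV \<pi> \<le> n"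
    unfolding cost_def
    by (subst Max_le_iff) (use *(1) finite_transcript_lengths[of \<pi> UNIV UNIV] in auto)
  finally show ?thesis by simp
qed

lemma ex_transcript_swap:
  fixes \<pi> :: "('a, 'b) protocol"
  shows "\<exists>\<pi>'. \<forall>a b. transcript \<pi>' b a = transcript \<pi> a b"
proof (induction \<pi>)
  case Stop
  show ?case by (intro exI[of _ Stop]) simp
next
  case (Alice p t0 t1)
  then obtain s0 s1 where "\<forall>a b. transcript s0 b a = transcript t0 a b"
      "\<forall>a b. transcript s1 b a = transcript t1 a b" by blast
  then show ?case by (intro exI[of _ "Bob p s0 s1"]) simp
next
  case (Bob q t0 t1)
  then obtain s0 s1 where "\<forall>a b. transcript s0 b a = transcript t0 a b"
      "\<forall>a b. transcript s1 b a = transcript t1 a b" by blast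
  then show ?case by (intro exI[of _ "Alice q s0 s1"]) simp
qed

text \<open>\<open>oot_correct\<close> is symmetric in the two outputs, so facts about messages of
  Alice carry over to Bob.\<close>

lemma oot_solvable_swap:
  fixes f :: "'x \<Rightarrow> 'y \<Rightarrow> 'z"
  assumes "oot_solvable Y X n (\<lambda>y x. f x y)"
  shows "oot_solvable X Y n f"
proof -
  obtain \<pi> outA outB where *: "\<forall>y\<in>Y. \<forall>x\<in>X. length (transcript \<pi> y x) \<le> n \<and>
      (outA (transcript \<pi> y x) y, outB (transcript \<pi> y x) x) \<in> oot_correct (f x y)"
    using assms unfolding oot_solvable_def by blast
  obtain \<pi>' where "\<forall>a b. transcript \<pi>' b a = transcript \<pi> a b"
    using ex_transcript_swap by blast
  moreover have "(a, b) \<in> oot_correct z \<longleftrightarrow> (b, a) \<in> oot_correct z" for a b and z :: 'z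
    by (auto simp: oot_correct_def)
  ultimately have "\<forall>x\<in>X. \<forall>y\<in>Y. length (transcript \<pi>' x y) \<le> n \<and>
      (outB (transcript \<pi>' x y) x, outA (transcript \<pi>' x y) y) \<in> oot_correct (f x y)"
    using * by metis
  then show ?thesis
    unfolding oot_solvable_def by blast
qed

lemma oot_solvable_mono:
  assumes "oot_solvable X Y n f" "X' \<subseteq> X" "Y' \<subseteq> Y" "n \<le> n'"
  shows "oot_solvable X' Y' n' f"
proof -
  obtain \<pi> outA outB where "\<forall>x\<in>X. \<forall>y\<in>Y. length (transcript \<pi> x y) \<le> n \<and>
      (outA (transcript \<pi> x y) x, outB (transcript \<pi> x y) y) \<in> oot_correct (f x y)"
    using assms(1) unfolding oot_solvable_def by blast
  then have "\<forall>x\<in>X'. \<forall>y\<in>Y'. length (transcript \<pi> x y) \<le> n' \<and>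
      (outA (transcript \<pi> x y) x, outB (transcript \<pi> x y) y) \<in> oot_correct (f x y)"
    using assms(2-4) by (meson le_trans subsetD)
  then show ?thesis unfolding oot_solvable_def by blast
qed

lemma oot_solvable_Alice_knows:
  assumes "\<And>x y. x \<in> X \<Longrightarrow> y \<in> Y \<Longrightarrow> f x y = g x"
  shows "oot_solvable X Y 0 f"
  unfolding oot_solvable_def
  by (intro exI[of _ Stop] exI[of _ "\<lambda>_ x. Some (g x)"] exI[of _ "\<lambda>_ _. None"])
     (simp add: assms oot_correct_def)

lemma oot_solvable_Bob_knows:
  assumes "\<And>x y. x \<in> X \<Longrightarrow> y \<in> Y \<Longrightarrow> f x y = g y"
  shows "oot_solvable X Y 0 f"
  by (rule oot_solvable_swap, rule oot_solvable_Alice_knows) (rule assms)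

lemma oot_solvable_Alice_bit:
  assumes "oot_solvable {x \<in> X. \<not> p x} Y n f" "oot_solvable {x \<in> X. p x} Y n f"
  shows "oot_solvable X Y (Suc n) f"
proof -
  obtain \<pi>0 outA0 outB0 where 0: "\<forall>x\<in>{x \<in> X. \<not> p x}. \<forall>y\<in>Y. length (transcript \<pi>0 x y) \<le> n \<and>
      (outA0 (transcript \<pi>0 x y) x, outB0 (transcript \<pi>0 x y) y) \<in> oot_correct (f x y)"
    using assms(1) unfolding oot_solvable_def by blast
  obtain \<pi>1 outA1 outB1 where 1: "\<forall>x\<in>{x \<in> X. p x}. \<forall>y\<in>Y. length (transcript \<pi>1 x y) \<le> n \<and>
      (outA1 (transcript \<pi>1 x y) x, outB1 (transcript \<pi>1 x y) y) \<in> oot_correct (f x y)"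
    using assms(2) unfolding oot_solvable_def by blast
  show ?thesis
    unfolding oot_solvable_def
    by (intro exI[of _ "Alice p \<pi>0 \<pi>1"]
          exI[of _ "\<lambda>w x. (if hd w then outA1 else outA0) (tl w) x"]
          exI[of _ "\<lambda>w y. (if hd w then outB1 else outB0) (tl w) y"])
       (use 0 1 in auto)
qed

text \<open>The message is located by halving: each bit tells in which part of the remaining values
  \<open>g x\<close> lies, until a single fibre of \<open>g\<close> is left.\<close>

lemma oot_solvable_Alice_sends:
  fixes g :: "'x \<Rightarrow> 'm"
  assumes "finite (g ` X)" "card (g ` X) \<le> 2 ^ n"
    and "\<And>s. oot_solvable {x \<in> X. g x = s} Y c f"
  shows "oot_solvable X Y (n + c) f"
  using assms
proof (induction n arbitrary: X)
  case 0
  then have "g ` X = {} \<or> (\<exists>s. g ` X = {s})"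
    by (metis One_nat_def card_0_eq card_1_singletonE le_Suc_eq le_zero_eq power_0)
  then obtain s where "X \<subseteq> {x \<in> X. g x = s}" by auto
  with 0(3)[of s] show ?case by (auto intro: oot_solvable_mono)
next
  case (Suc n)
  \<comment> \<open>This size leaves at most \<open>2 ^ n\<close> values of \<open>g\<close> both
    inside and outside \<open>S\<close>, even when \<open>g\<close> takes few values.\<close>
  obtain S where S: "S \<subseteq> g ` X" "card S = min (2 ^ n) (card (g ` X))"
    by (metis min.cobounded2 obtain_subset_with_card_n)
  have finS: "finite S" using S(1) Suc.prems(1) finite_subset by blast
  have sub: "oot_solvable {x \<in> X'. g x = s} Y c f" if "X' \<subseteq> X" for X' s
    using that by (intro oot_solvable_mono[OF Suc.prems(3)[of s]]) auto
  have img: "g ` {x \<in> X. g x \<in> S} = S" "g ` {x \<in> X. \<not> g x \<in> S} = g ` X - S"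
    using S(1) by auto
  have "card (g ` X - S) = card (g ` X) - card S"
    using S(1) finS by (simp add: card_Diff_subset)
  then have card: "card (g ` X - S) \<le> 2 ^ n"
    using S(2) Suc.prems(2) by (simp add: min_def split: if_splits)
  have "oot_solvable {x \<in> X. \<not> g x \<in> S} Y (n + c) f"
    using Suc.prems(1) card by (intro Suc.IH sub) (auto simp: img)
  moreover have "oot_solvable {x \<in> X. g x \<in> S} Y (n + c) f"
    using finS S(2) by (intro Suc.IH sub) (auto simp: img)
  ultimately show ?case
    using oot_solvable_Alice_bit[of X "\<lambda>x. g x \<in> S"] by simp
qed

lemma oot_solvable_Bob_sends:
  fixes g :: "'y \<Rightarrow> 'm"
  assumes "finite (g ` Y)" "card (g ` Y) \<le> 2 ^ n"
    and "\<And>s. oot_solvable X {y \<in> Y. g y = s} c f"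
  shows "oot_solvable X Y (n + c) f"
  using assms by (intro oot_solvable_swap[of Y] oot_solvable_Alice_sends[of g])
    (auto intro: oot_solvable_swap)

section \<open>Rounding of probabilities\<close>

text \<open>The cap at \<open>2 ^ m - 1\<close> only matters for \<open>v = 1\<close>, and there the error is still \<open>1 / 2 ^ m\<close>.\<close>

definition quant :: "nat \<Rightarrow> real \<Rightarrow> nat" where
  "quant m v = min (nat \<lfloor>v * 2 ^ m\<rfloor>) (2 ^ m - 1)"

lemma quant_less: "quant m v < 2 ^ m"
  by (simp add: quant_def min_less_iff_disj)

lemma quant_image: "finite ((\<lambda>x. quant m (v x)) ` X)" "card ((\<lambda>x. quant m (v x)) ` X) \<le> 2 ^ m"
proof -
  have sub: "(\<lambda>x. quant m (v x)) ` X \<subseteq> {..<2 ^ m}"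
    using quant_less by auto
  show "finite ((\<lambda>x. quant m (v x)) ` X)"
    using sub finite_subset by blast
  show "card ((\<lambda>x. quant m (v x)) ` X) \<le> 2 ^ m"
    using card_mono[OF _ sub] by simp
qed

lemma quant_bounds:
  assumes "0 \<le> v" "v \<le> 1"
  shows "real (quant m v) / 2 ^ m \<le> v" "v \<le> real (quant m v) / 2 ^ m + 1 / 2 ^ m"
proof -
  have nn: "0 \<le> v * 2 ^ m" and le: "v * 2 ^ m \<le> 2 ^ m" using assms by auto
  have fl: "real (nat \<lfloor>v * 2 ^ m\<rfloor>) = of_int \<lfloor>v * 2 ^ m\<rfloor>" using nn by simp
  have "real (quant m v) \<le> real (nat \<lfloor>v * 2 ^ m\<rfloor>)" by (simp add: quant_def)
  also have "\<dots> \<le> v * 2 ^ m" using fl by linarith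
  finally show "real (quant m v) / 2 ^ m \<le> v" by (simp add: field_simps)
  have "v * 2 ^ m \<le> real (quant m v) + 1"
  proof (cases "nat \<lfloor>v * 2 ^ m\<rfloor> \<le> 2 ^ m - 1")
    case True
    then have "quant m v = nat \<lfloor>v * 2 ^ m\<rfloor>" by (simp add: quant_def)
    then show ?thesis using fl by linarith
  next
    case False
    then have "quant m v = 2 ^ m - 1" by (simp add: quant_def)
    then show ?thesis using le by (simp add: of_nat_diff)
  qed
  then show "v \<le> real (quant m v) / 2 ^ m + 1 / 2 ^ m"
    by (simp add: field_simps)
qed

section \<open>From private-coin protocols to weights\<close>

text \<open>Each node consults only one player. Along the common path \<open>t\<close>, Alice's bits
  fit \<open>a\<close> and Bob's fit \<open>b'\<close>, so the mixed pair walks the same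
  path.\<close>

lemma transcript_rectangle:
  "transcript \<pi> a b = t \<Longrightarrow> transcript \<pi> a' b' = t \<Longrightarrow> transcript \<pi> a b' = t"
  by (induction \<pi> arbitrary: t) (auto split: if_splits)

text \<open>Transcripts are leaves of a binary tree of depth at most \<open>n\<close>; counting all
  strings of length at most \<open>n\<close> would lose a factor of almost \<open>2\<close>. Each
  branch is counted on the inputs that reach it.\<close>

lemma card_transcripts:
  assumes "\<And>a b. a \<in> A \<Longrightarrow> b \<in> B \<Longrightarrow> length (transcript \<pi> a b) \<le> n"
  shows "finite {transcript \<pi> a b | a b. a \<in> A \<and> b \<in> B} \<and>
    card {transcript \<pi> a b | a b. a \<in> A \<and> b \<in> B} \<le> 2 ^ n"
  using assms
proof (induction \<pi> arbitrary: A B n)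
  case Stop
  have "{transcript Stop a b | a b. a \<in> A \<and> b \<in> B} \<subseteq> {[]}" by auto
  moreover from card_mono[OF _ this] have
    "card {transcript Stop a b | a b. a \<in> A \<and> b \<in> B} \<le> 2 ^ n"
    by (simp add: order_trans[OF _ one_le_power])
  ultimately show ?case using finite_subset by blast
next
  case (Alice p t0 t1)
  show ?case
  \<comment> \<open>A transcript through this node shows \<open>n > 0\<close>; on an empty rectangle
    the length bound says nothing about \<open>n\<close>.\<close>
  proof (cases "A = {} \<or> B = {}")
    case False
    then obtain a b where ab: "a \<in> A" "b \<in> B" by blast
    obtain n' where n: "n = Suc n'"
      using Alice.prems[OF ab] by (cases n) auto
    let ?S0 = "{transcript t0 a b | a b. a \<in> {a \<in> A. \<not> p a} \<and> b \<in> B}"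
    let ?S1 = "{transcript t1 a b | a b. a \<in> {a \<in> A. p a} \<and> b \<in> B}"
    have 0: "finite ?S0 \<and> card ?S0 \<le> 2 ^ n'"
      by (rule Alice.IH(1)) (use Alice.prems n in force)
    have 1: "finite ?S1 \<and> card ?S1 \<le> 2 ^ n'"
      by (rule Alice.IH(2)) (use Alice.prems n in force)
    have eq: "{transcript (Alice p t0 t1) a b | a b. a \<in> A \<and> b \<in> B} =
        (Cons False ` ?S0) \<union> (Cons True ` ?S1)"
      by (auto split: if_splits simp: image_iff)
    have "card (Cons False ` ?S0 \<union> Cons True ` ?S1) \<le> card ?S0 + card ?S1"
      by (intro order_trans[OF card_Un_le] add_mono card_image_le) (use 0 1 in blast)+
    then show ?thesis unfolding eq n using 0 1 by auto
  qed auto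
next
  case (Bob p t0 t1)
  show ?case
  proof (cases "A = {} \<or> B = {}")
    case False
    then obtain a b where ab: "a \<in> A" "b \<in> B" by blast
    obtain n' where n: "n = Suc n'"
      using Bob.prems[OF ab] by (cases n) auto
    let ?S0 = "{transcript t0 a b | a b. a \<in> A \<and> b \<in> {b \<in> B. \<not> p b}}"
    let ?S1 = "{transcript t1 a b | a b. a \<in> A \<and> b \<in> {b \<in> B. p b}}"
    have 0: "finite ?S0 \<and> card ?S0 \<le> 2 ^ n'"
      by (rule Bob.IH(1)) (use Bob.prems n in force)
    have 1: "finite ?S1 \<and> card ?S1 \<le> 2 ^ n'"
      by (rule Bob.IH(2)) (use Bob.prems n in force)
    have eq: "{transcript (Bob p t0 t1) a b | a b. a \<in> A \<and> b \<in> B} =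
        (Cons False ` ?S0) \<union> (Cons True ` ?S1)"
      by (auto split: if_splits simp: image_iff)
    have "card (Cons False ` ?S0 \<union> Cons True ` ?S1) \<le> card ?S0 + card ?S1"
      by (intro order_trans[OF card_Un_le] add_mono card_image_le) (use 0 1 in blast)+
    then show ?thesis unfolding eq n using 0 1 by auto
  qed auto
qed

text \<open>This replaces the protocol and its coins by plain numbers. Independence makes each joint
  probability a product, and the total is at most \<open>1\<close> because the success events for
  distinct \<open>z\<close> are disjoint.\<close>

lemma priv_oot_protocol_weights:
  fixes f :: "'x \<Rightarrow> 'y \<Rightarrow> 'z::finite"
  assumes "priv_oot_protocol \<epsilon> \<mu> \<nu> \<pi> outA outB f"
    and "cost (UNIV \<times> set_pmf \<mu>) (UNIV \<times> set_pmf \<nu>) \<pi> \<le> R"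
  obtains T :: "bool list set" and p :: "'x \<Rightarrow> bool list \<Rightarrow> 'z option \<Rightarrow> real"
    and q :: "'y \<Rightarrow> bool list \<Rightarrow> 'z option \<Rightarrow> real"
  where "finite T" "card T \<le> 2 ^ R"
    "\<And>x t w. 0 \<le> p x t w" "\<And>x t w. p x t w \<le> 1" "\<And>y t w. 0 \<le> q y t w" "\<And>y t w. q y t w \<le> 1"
    "\<And>x y. (\<Sum>z\<in>UNIV. \<Sum>t\<in>T. p x t None * q y t (Some z) + p x t (Some z) * q y t None) \<le> 1"
    "\<And>x y. 1 - \<epsilon> \<le>
       (\<Sum>t\<in>T. p x t None * q y t (Some (f x y)) + p x t (Some (f x y)) * q y t None)"
proof -
  define T where "T = {transcript \<pi> a b | a b. a \<in> UNIV \<times> set_pmf \<mu> \<and> b \<in> UNIV \<times> set_pmf \<nu>}"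
  \<comment> \<open>By the rectangle property, \<open>t\<close> occurs iff each player's input and coins are compatible with
    \<open>t\<close> for some behaviour of the other player.\<close>
  define PA where "PA x t w = {r \<in> set_pmf \<mu>. (\<exists>y. \<exists>s\<in>set_pmf \<nu>. transcript \<pi> (x, r) (y, s) = t)
    \<and> outA t r x = w}" for x t w
  define PB where "PB y t w = {s \<in> set_pmf \<nu>. (\<exists>x. \<exists>r\<in>set_pmf \<mu>. transcript \<pi> (x, r) (y, s) = t)
    \<and> outB t s y = w}" for y t w
  let ?P = "measure_pmf.prob (pair_pmf \<mu> \<nu>)"
  let ?p = "\<lambda>x t w. measure_pmf.prob \<mu> (PA x t w)"
  let ?q = "\<lambda>y t w. measure_pmf.prob \<nu> (PB y t w)"
  define E where "E x y z = {(r, s). (outA (transcript \<pi> (x, r) (y, s)) r x,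
      outB (transcript \<pi> (x, r) (y, s)) s y) \<in> oot_correct z}" for x y z
  have len: "length (transcript \<pi> a b) \<le> R"
    if "a \<in> UNIV \<times> set_pmf \<mu>" "b \<in> UNIV \<times> set_pmf \<nu>" for a b
  proof -
    have "length (transcript \<pi> a b) \<le> cost (UNIV \<times> set_pmf \<mu>) (UNIV \<times> set_pmf \<nu>) \<pi>"
      unfolding cost_def by (rule Max_ge[OF finite_transcript_lengths]) (use that in blast)
    with assms(2) show ?thesis by simp
  qed
  have "finite T \<and> card T \<le> 2 ^ R"
    unfolding T_def by (rule card_transcripts) (rule len)
  then have T: "finite T" "card T \<le> 2 ^ R" by auto
  have tr: "transcript \<pi> (x, r) (y, s) = t" if "r \<in> PA x t w" "s \<in> PB y t w'" for x y r s t w w'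
    using that transcript_rectangle[of \<pi> "(x, r)" _ t _ "(y, s)"] unfolding PA_def PB_def by blast
  define C where "C x y z t = PA x t None \<times> PB y t (Some z) \<union> PA x t (Some z) \<times> PB y t None"
    for x y z t
  \<comment> \<open>Coins of probability zero may lead outside \<open>T\<close>, hence the
    intersection with the support.\<close>
  have E_eq: "E x y z \<inter> set_pmf (pair_pmf \<mu> \<nu>) = (\<Union>t\<in>T. C x y z t)" for x y z
  proof (intro equalityI subsetI)
    fix rs assume "rs \<in> E x y z \<inter> set_pmf (pair_pmf \<mu> \<nu>)"
    then obtain r s where rs: "rs = (r, s)" "r \<in> set_pmf \<mu>" "s \<in> set_pmf \<nu>" "(r, s) \<in> E x y z"
      by auto
    define t where "t = transcript \<pi> (x, r) (y, s)"
    have "t \<in> T" unfolding T_def t_def using rs by blast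
    moreover have "rs \<in> C x y z t"
      using rs unfolding C_def PA_def PB_def E_def oot_correct_def t_def[symmetric]
      by (auto simp: t_def)
    ultimately show "rs \<in> (\<Union>t\<in>T. C x y z t)" by blast
  next
    fix rs assume "rs \<in> (\<Union>t\<in>T. C x y z t)"
    then obtain r s t where rs: "rs = (r, s)"
        "r \<in> PA x t None \<and> s \<in> PB y t (Some z) \<or> r \<in> PA x t (Some z) \<and> s \<in> PB y t None"
      unfolding C_def by blast
    then have "transcript \<pi> (x, r) (y, s) = t" using tr by blast
    then show "rs \<in> E x y z \<inter> set_pmf (pair_pmf \<mu> \<nu>)"
      using rs by (auto simp: E_def PA_def PB_def oot_correct_def)
  qed
  have prob_C: "?P (C x y z t) = ?p x t None * ?q y t (Some z) + ?p x t (Some z) * ?q y t None"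
    for x y z t
  proof -
    have "?P (C x y z t) = ?P (PA x t None \<times> PB y t (Some z)) + ?P (PA x t (Some z) \<times> PB y t None)"
      unfolding C_def by (rule measure_pmf.finite_measure_Union) (auto simp: PA_def)
    then show ?thesis by (simp add: measure_pmf_prob_product)
  qed
  have prob_E: "?P (E x y z) = (\<Sum>t\<in>T. ?p x t None * ?q y t (Some z) + ?p x t (Some z) * ?q y t None)"
    for x y z
  proof -
    have "?P (E x y z) = ?P (\<Union>t\<in>T. C x y z t)"
      by (subst measure_Int_set_pmf[symmetric]) (simp only: E_eq)
    also have "\<dots> = (\<Sum>t\<in>T. ?P (C x y z t))"
    proof (rule measure_pmf.finite_measure_finite_Union)
      show "disjoint_family_on (C x y z) T"
        unfolding disjoint_family_on_def C_def by (auto dest: tr)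
    qed (use T in auto)
    also have "\<dots> = (\<Sum>t\<in>T. ?p x t None * ?q y t (Some z) + ?p x t (Some z) * ?q y t None)"
      by (simp only: prob_C)
    finally show ?thesis .
  qed
  show thesis
  proof (rule that[of T ?p ?q])
    fix x y
    have "(\<Sum>z\<in>UNIV. ?P (E x y z)) = ?P (\<Union>z\<in>UNIV. E x y z)"
      by (rule measure_pmf.finite_measure_finite_Union[symmetric])
        (auto simp: disjoint_family_on_def E_def oot_correct_def)
    also have "\<dots> \<le> 1" by simp
    finally show "(\<Sum>z\<in>UNIV. \<Sum>t\<in>T. ?p x t None * ?q y t (Some z) + ?p x t (Some z) * ?q y t None) \<le> 1"
      by (simp only: prob_E)
    have "1 - \<epsilon> \<le> ?P (E x y (f x y))"
      using assms(1) unfolding priv_oot_protocol_def E_def by blast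
    then show "1 - \<epsilon> \<le>
        (\<Sum>t\<in>T. ?p x t None * ?q y t (Some (f x y)) + ?p x t (Some (f x y)) * ?q y t None)"
      by (simp only: prob_E)
  qed (use T in auto)
qed

section \<open>Exchange of rounded weights\<close>

text \<open>Only the weights of \<open>None\<close> are sent, so the cost of the exchange does not
  depend on the number of values. Rounding down keeps the total at most \<open>1\<close>. Each of
  the at most \<open>2 ^ R\<close> transcripts loses at most \<open>1 / 2 ^ m\<close> in each of its
  two products, which gives the error term in \<open>step\<close>.\<close>

lemma oot_solvable_exchange:
  fixes f :: "'x \<Rightarrow> 'y \<Rightarrow> 'z::finite"
  assumes "priv_oot_protocol \<epsilon> \<mu> \<nu> \<pi> outA outB f"
    and "cost (UNIV \<times> set_pmf \<mu>) (UNIV \<times> set_pmf \<nu>) \<pi> \<le> R"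
    and step: "\<And>X Y (A :: 'x \<Rightarrow> 'z \<Rightarrow> real) B. (\<And>x z. 0 \<le> A x z) \<Longrightarrow> (\<And>y z. 0 \<le> B y z) \<Longrightarrow>
      (\<And>x y. x \<in> X \<Longrightarrow> y \<in> Y \<Longrightarrow> (\<Sum>z\<in>UNIV. A x z + B y z) \<le> 1) \<Longrightarrow>
      (\<And>x y. x \<in> X \<Longrightarrow> y \<in> Y \<Longrightarrow> 1 - \<epsilon> - 2 * (2 ^ R / 2 ^ m) \<le> A x (f x y) + B y (f x y)) \<Longrightarrow>
      oot_solvable X Y c f"
  shows "oot_solvable UNIV UNIV (m * 2 ^ R + (m * 2 ^ R + c)) f"
proof -
  obtain T :: "bool list set" and p :: "'x \<Rightarrow> bool list \<Rightarrow> 'z option \<Rightarrow> real"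
    and q :: "'y \<Rightarrow> bool list \<Rightarrow> 'z option \<Rightarrow> real"
  where T: "finite T" "card T \<le> 2 ^ R"
    and p: "\<And>x t w. 0 \<le> p x t w" "\<And>x t w. p x t w \<le> 1"
    and q: "\<And>y t w. 0 \<le> q y t w" "\<And>y t w. q y t w \<le> 1"
    and total: "\<And>x y.
      (\<Sum>z\<in>UNIV. \<Sum>t\<in>T. p x t None * q y t (Some z) + p x t (Some z) * q y t None) \<le> 1"
    and correct: "\<And>x y. 1 - \<epsilon> \<le>
       (\<Sum>t\<in>T. p x t None * q y t (Some (f x y)) + p x t (Some (f x y)) * q y t None)"
    by (rule priv_oot_protocol_weights[OF assms(1,2)]) blast
  \<comment> \<open>Restriction to \<open>T\<close> fixes the function elsewhere, so that there are
    only finitely many messages.\<close>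
  define u where "u x = restrict (\<lambda>t. quant m (p x t None)) T" for x
  define v where "v y = restrict (\<lambda>t. quant m (q y t None)) T" for y
  have image: "finite (g ` Z)" "card (g ` Z) \<le> 2 ^ (m * 2 ^ R)"
    if g: "g ` Z \<subseteq> T \<rightarrow>\<^sub>E {..<2 ^ m}" for g :: "'i \<Rightarrow> bool list \<Rightarrow> nat" and Z
  proof -
    have fin: "finite (T \<rightarrow>\<^sub>E {..<2 ^ m :: nat})"
      using T by (auto intro: finite_PiE)
    with g show "finite (g ` Z)" by (rule finite_subset)
    have "card (g ` Z) \<le> card (T \<rightarrow>\<^sub>E {..<2 ^ m :: nat})"
      by (rule card_mono[OF fin g])
    also have "\<dots> = 2 ^ (m * card T)"
      using T by (simp add: card_PiE power_mult)
    also have "\<dots> \<le> 2 ^ (m * 2 ^ R)"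
      using T by (intro power_increasing) auto
    finally show "card (g ` Z) \<le> 2 ^ (m * 2 ^ R)" .
  qed
  have u: "u ` UNIV \<subseteq> T \<rightarrow>\<^sub>E {..<2 ^ m}"
    using quant_less[of m] by (auto simp: u_def)
  have v: "v ` UNIV \<subseteq> T \<rightarrow>\<^sub>E {..<2 ^ m}"
    using quant_less[of m] by (auto simp: v_def)
  have "oot_solvable {x \<in> UNIV. u x = s} {y \<in> UNIV. v y = s'} c f" for s s'
  proof (rule step)
    \<comment> \<open>With both messages fixed, \<open>A\<close> can be evaluated by Alice alone and
      \<open>B\<close> by Bob alone.\<close>
    define A where "A x z = (\<Sum>t\<in>T. p x t (Some z) * (real (s' t) / 2 ^ m))" for x z
    define B where "B y z = (\<Sum>t\<in>T. real (s t) / 2 ^ m * q y t (Some z))" for y z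
    show "0 \<le> A x z" for x z using p by (auto simp: A_def intro!: sum_nonneg)
    show "0 \<le> B y z" for y z using q by (auto simp: B_def intro!: sum_nonneg)
    fix x y assume "x \<in> {x \<in> UNIV. u x = s}" "y \<in> {y \<in> UNIV. v y = s'}"
    then have "s t = quant m (p x t None)" "s' t = quant m (q y t None)" if "t \<in> T" for t
      using that by (auto simp: u_def v_def)
    then have s: "real (s t) / 2 ^ m \<le> p x t None" "p x t None \<le> real (s t) / 2 ^ m + 1 / 2 ^ m"
        "real (s' t) / 2 ^ m \<le> q y t None" "q y t None \<le> real (s' t) / 2 ^ m + 1 / 2 ^ m"
      if "t \<in> T" for t
      using that quant_bounds p q by auto
    have "A x z + B y z \<le> (\<Sum>t\<in>T. p x t None * q y t (Some z) + p x t (Some z) * q y t None)" for z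
      unfolding A_def B_def sum.distrib[symmetric]
    proof (rule sum_mono)
      fix t assume t: "t \<in> T"
      show "p x t (Some z) * (real (s' t) / 2 ^ m) + real (s t) / 2 ^ m * q y t (Some z)
          \<le> p x t None * q y t (Some z) + p x t (Some z) * q y t None"
        using mult_left_mono[OF s(3)[OF t] p(1)[of x t "Some z"]]
          mult_right_mono[OF s(1)[OF t] q(1)[of y t "Some z"]] by linarith
    qed
    then have "(\<Sum>z\<in>UNIV. A x z + B y z)
        \<le> (\<Sum>z\<in>UNIV. \<Sum>t\<in>T. p x t None * q y t (Some z) + p x t (Some z) * q y t None)"
      by (rule sum_mono)
    then show "(\<Sum>z\<in>UNIV. A x z + B y z) \<le> 1" using total order_trans by blast
    define z where "z = f x y"
    have "(\<Sum>t\<in>T. p x t None * q y t (Some z) + p x t (Some z) * q y t None)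
        \<le> (\<Sum>t\<in>T. p x t (Some z) * (real (s' t) / 2 ^ m) + real (s t) / 2 ^ m * q y t (Some z)
             + 2 * (1 / 2 ^ m))"
    proof (rule sum_mono)
      fix t assume t: "t \<in> T"
      have "p x t None * q y t (Some z) \<le> (real (s t) / 2 ^ m + 1 / 2 ^ m) * q y t (Some z)"
        using mult_right_mono[OF s(2)[OF t] q(1)] .
      moreover have "1 / 2 ^ m * q y t (Some z) \<le> 1 / 2 ^ m"
        by (rule mult_left_le) (use q in auto)
      moreover have "p x t (Some z) * q y t None \<le> p x t (Some z) * (real (s' t) / 2 ^ m + 1 / 2 ^ m)"
        using mult_left_mono[OF s(4)[OF t] p(1)] .
      moreover have "p x t (Some z) * (1 / 2 ^ m) \<le> 1 / 2 ^ m"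
        by (rule mult_left_le_one_le) (use p in auto)
      ultimately show "p x t None * q y t (Some z) + p x t (Some z) * q y t None
          \<le> p x t (Some z) * (real (s' t) / 2 ^ m) + real (s t) / 2 ^ m * q y t (Some z)
            + 2 * (1 / 2 ^ m)"
        unfolding distrib_left distrib_right by linarith
    qed
    also have "\<dots> = A x z + B y z + real (card T) * (2 * (1 / 2 ^ m))"
      unfolding A_def B_def by (simp add: sum.distrib)
    also have "real (card T) * (2 * (1 / 2 ^ m)) \<le> 2 ^ R * (2 * (1 / 2 ^ m))"
      using of_nat_mono[OF T(2), where 'a = real] by (intro mult_right_mono) auto
    finally show "1 - \<epsilon> - 2 * (2 ^ R / 2 ^ m) \<le> A x (f x y) + B y (f x y)"
      using correct[of x y] unfolding z_def by simp
  qed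
  then show ?thesis
    by (intro oot_solvable_Alice_sends[OF image[OF u]] oot_solvable_Bob_sends[OF image[OF v]])
qed

section \<open>Binary codes and heaviest values\<close>

lemma ceiling_log2_le_power:
  assumes "0 < n"
  shows "n \<le> 2 ^ nat \<lceil>log 2 (real n)\<rceil>"
proof -
  have "log 2 (real n) \<le> real (nat \<lceil>log 2 (real n)\<rceil>)" by linarith
  then have "2 powr log 2 (real n) \<le> 2 powr real (nat \<lceil>log 2 (real n)\<rceil>)"
    by (intro powr_mono) auto
  then have "real n \<le> 2 powr real (nat \<lceil>log 2 (real n)\<rceil>)"
    using assms by (simp only: powr_log_cancel[of 2] of_nat_0_less_iff)
  also have "\<dots> = real (2 ^ nat \<lceil>log 2 (real n)\<rceil>)" by (simp add: powr_realpow)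
  finally show ?thesis by (simp only: of_nat_le_iff)
qed

lemma ex_separating_code:
  assumes "CARD('z::finite) \<le> 2 ^ k"
  shows "\<exists>code :: 'z \<Rightarrow> nat \<Rightarrow> bool. \<forall>z z'. z \<noteq> z' \<longrightarrow> (\<exists>i<k. code z i \<noteq> code z' i)"
proof -
  have "card (UNIV :: 'z set) \<le> card (Pow {..<k})"
    using assms by (simp add: card_Pow)
  then obtain g :: "'z \<Rightarrow> nat set" where g: "g ` UNIV \<subseteq> Pow {..<k}" "inj g"
    using card_le_inj[of "UNIV :: 'z set" "Pow {..<k}"] by auto
  have "\<exists>i<k. (i \<in> g z) \<noteq> (i \<in> g z')" if ne: "z \<noteq> z'" for z z'
  proof -
    have "g z \<noteq> g z'" using g(2) ne by (auto dest: injD)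
    moreover have "g z \<subseteq> {..<k}" "g z' \<subseteq> {..<k}" using g(1) by auto
    ultimately show ?thesis by auto
  qed
  then show ?thesis by (intro exI[of _ "\<lambda>z i. i \<in> g z"]) blast
qed

text \<open>\<open>a\<close> and \<open>b\<close> stay distinct even under ties, so any further
  value has two others at least as heavy.\<close>

lemma ex_top_two:
  fixes w :: "'z::finite \<Rightarrow> real"
  assumes "2 \<le> CARD('z)"
  shows "\<exists>a b. a \<noteq> b \<and> w b \<le> w a \<and> (\<forall>z. z \<noteq> a \<longrightarrow> w z \<le> w b)"
proof -
  have "finite (w ` UNIV)" "w ` UNIV \<noteq> {}" by auto
  from Max_in[OF this] obtain a where "w a = Max (range w)" by (metis imageE)
  then have a: "w z \<le> w a" for z by simp
  have "UNIV - {a} \<noteq> {}"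
  proof
    assume "UNIV - {a} = {}"
    then have "CARD('z) \<le> card {a}" by (intro card_mono) auto
    with assms show False by simp
  qed
  then have "finite (w ` (UNIV - {a}))" "w ` (UNIV - {a}) \<noteq> {}" by auto
  from Max_in[OF this] obtain b where b: "b \<noteq> a" "w b = Max (w ` (UNIV - {a}))"
    by (metis imageE DiffD2 singletonI)
  have "w z \<le> w b" if "z \<noteq> a" for z
    unfolding b(2) by (rule Max_ge) (use that in auto)
  with a b(1) show ?thesis by metis
qed

section \<open>Error below one third\<close>

lemma oot_solvable_third:
  fixes f :: "'x \<Rightarrow> 'y \<Rightarrow> 'z::finite"
  assumes nonneg: "\<And>x z. 0 \<le> A x z" "\<And>y z. 0 \<le> B y z"
    and total: "\<And>x y. x \<in> X \<Longrightarrow> y \<in> Y \<Longrightarrow> (\<Sum>z\<in>UNIV. A x z + B y z) \<le> (1::real)"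
    and correct: "\<And>x y. x \<in> X \<Longrightarrow> y \<in> Y \<Longrightarrow> 2/3 < A x (f x y) + B y (f x y)"
  shows "oot_solvable X Y 1 f"
proof -
  have wrong: "A x z + B y z < 1/3" if "x \<in> X" "y \<in> Y" "z \<noteq> f x y" for x y z
  proof -
    have "(\<Sum>z'\<in>{z, f x y}. A x z' + B y z') \<le> (\<Sum>z'\<in>UNIV. A x z' + B y z')"
      by (rule sum_mono2) (use nonneg in auto)
    with total[OF that(1,2)] correct[OF that(1,2)] that(3) show ?thesis by simp
  qed
  \<comment> \<open>Bob's bit says whether he answers. If not, his share of the correct value is at
    most \<open>1/3\<close>, so Alice's exceeds \<open>1/3\<close>.\<close>
  define p where "p y \<longleftrightarrow> (\<exists>z. 1/3 < B y z)" for y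
  have "oot_solvable X {y \<in> Y. p y = s} 0 f" for s
  proof (cases s)
    case True
    show ?thesis
    proof (rule oot_solvable_Bob_knows)
      fix x y assume xy: "x \<in> X" "y \<in> {y \<in> Y. p y = s}"
      then have "\<exists>z. 1/3 < B y z" using True p_def by auto
      from someI_ex[OF this] have "1/3 < B y (SOME z. 1/3 < B y z)" .
      moreover have "f x y = z" if "1/3 < B y z" for z
        by (rule ccontr) (use wrong[of x y z] nonneg(1)[of x z] xy that in auto)
      ultimately show "f x y = (SOME z. 1/3 < B y z)" by blast
    qed
  next
    case False
    show ?thesis
    proof (rule oot_solvable_Alice_knows)
      fix x y assume xy: "x \<in> X" "y \<in> {y \<in> Y. p y = s}"
      then have "B y (f x y) \<le> 1/3" using False by (simp add: p_def not_less)
      then have "\<exists>z. 1/3 < A x z" using correct[of x y] xy by (intro exI[of _ "f x y"]) auto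
      from someI_ex[OF this] have "1/3 < A x (SOME z. 1/3 < A x z)" .
      moreover have "f x y = z" if "1/3 < A x z" for z
        by (rule ccontr) (use wrong[of x y z] nonneg(2)[of y z] xy that in auto)
      ultimately show "f x y = (SOME z. 1/3 < A x z)" by blast
    qed
  qed
  moreover have "finite (p ` Y)" "card (p ` Y) \<le> 2 ^ 1"
    using card_mono[of "UNIV :: bool set" "p ` Y"] finite_subset[of "p ` Y" UNIV] by auto
  ultimately have "oot_solvable X Y (1 + 0) f" by (intro oot_solvable_Bob_sends) auto
  then show ?thesis by simp
qed

section \<open>Error below one half\<close>

lemma oot_solvable_two_candidates:
  fixes f :: "'x \<Rightarrow> 'y \<Rightarrow> 'z::finite" and code :: "'z \<Rightarrow> nat \<Rightarrow> bool"
  assumes nonneg: "\<And>x z. 0 \<le> A x z" "\<And>y z. 0 \<le> B y z"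
    and total: "\<And>x y. x \<in> X \<Longrightarrow> y \<in> Y \<Longrightarrow> (\<Sum>z\<in>UNIV. A x z + B y z) \<le> (1::real)"
    and correct: "\<And>x y. x \<in> X \<Longrightarrow> y \<in> Y \<Longrightarrow> 1/2 + d \<le> A x (f x y) + B y (f x y)"
    and d: "1 / 2 ^ m < 2 * d"
    and cand: "\<And>x y. x \<in> X \<Longrightarrow> y \<in> Y \<Longrightarrow> f x y = c1 x \<or> f x y = c2 x"
      "\<And>x. x \<in> X \<Longrightarrow> c1 x \<noteq> c2 x"
    and code: "\<And>z z'. z \<noteq> z' \<Longrightarrow> \<exists>i<k. code z i \<noteq> code z' i"
    and l: "k \<le> 2 ^ l"
  shows "oot_solvable X Y (l + m) f"
proof -
  define g where "g x = (SOME i. i < k \<and> code (c1 x) i \<noteq> code (c2 x) i)" for x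
  have g: "g x < k \<and> code (c1 x) (g x) \<noteq> code (c2 x) (g x)" if "x \<in> X" for x
    unfolding g_def by (rule someI_ex) (use code cand(2)[OF that] in blast)
  then have img: "g ` X \<subseteq> {..<k}" by auto
  have "oot_solvable {x \<in> X. g x = i} Y m f" for i
  proof -
    define Z where "Z = {z. code z i}"
    let ?h = "\<lambda>y. quant m (sum (B y) Z)"
    have "oot_solvable {x \<in> X. g x = i} {y \<in> Y. ?h y = s} 0 f" for s
    proof (rule oot_solvable_Alice_knows)
      fix x y assume xy: "x \<in> {x \<in> X. g x = i}" "y \<in> {y \<in> Y. ?h y = s}"
      then have x: "x \<in> X" and y: "y \<in> Y" by auto
      have AB: "sum (A x) S + sum (B y) S \<le> 1" for S
      proof -
        have "(\<Sum>z\<in>S. A x z + B y z) \<le> (\<Sum>z\<in>UNIV. A x z + B y z)"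
          by (rule sum_mono2) (use nonneg in auto)
        with total[OF x y] show ?thesis by (simp add: sum.distrib)
      qed
      have "0 \<le> sum (B y) Z" "sum (B y) Z \<le> 1"
        using AB[of Z] sum_nonneg[of Z "A x"] sum_nonneg[of Z "B y"] nonneg by auto
      note s = quant_bounds[OF this, of m]
      \<comment> \<open>The exact weight of \<open>Z\<close> is at least \<open>1/2 + d\<close> if
        the correct value lies in \<open>Z\<close> and at most \<open>1/2 - d\<close> otherwise.
        Rounding down loses at most \<open>1 / 2 ^ m < 2 * d\<close>, so the threshold
        \<open>1/2 - d\<close> still separates the cases.\<close>
      let ?dec = "sum (A x) Z + real s / 2 ^ m > 1/2 - d"
      have "code (f x y) i \<longleftrightarrow> ?dec"
      proof
        assume "code (f x y) i"
        then have "f x y \<in> Z" by (simp add: Z_def)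
        then have "A x (f x y) \<le> sum (A x) Z" "B y (f x y) \<le> sum (B y) Z"
          using nonneg by (auto intro: member_le_sum)
        then show ?dec using s xy correct[OF x y] d by auto
      next
        assume dec: ?dec
        show "code (f x y) i"
        proof (rule ccontr)
          assume "\<not> code (f x y) i"
          then have "f x y \<notin> Z" by (simp add: Z_def)
          then have "sum (A x) Z + sum (B y) Z + (A x (f x y) + B y (f x y)) \<le> 1"
            using AB[of "insert (f x y) Z"] by simp
          then show False using s xy correct[OF x y] dec by auto
        qed
      qed
      then show "f x y = (if code (c1 x) i = ?dec then c1 x else c2 x)"
        using g[OF x] cand(1)[OF x y] xy by auto
    qed
    then have "oot_solvable {x \<in> X. g x = i} Y (m + 0) f"
      by (intro oot_solvable_Bob_sends[OF quant_image])
    then show ?thesis by simp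
  qed
  moreover have "finite (g ` X)" "card (g ` X) \<le> 2 ^ l"
    using img finite_subset card_mono[OF _ img] l by auto
  ultimately show ?thesis by (intro oot_solvable_Alice_sends)
qed

text \<open>The summands of the cost are Alice's rounded maximum, Bob's bit telling which player has
  two candidates, the position in the code, and the weight of its class.\<close>

lemma oot_solvable_half:
  fixes f :: "'x \<Rightarrow> 'y \<Rightarrow> 'z::finite"
  assumes nonneg: "\<And>x z. 0 \<le> A x z" "\<And>y z. 0 \<le> B y z"
    and total: "\<And>x y. x \<in> X \<Longrightarrow> y \<in> Y \<Longrightarrow> (\<Sum>z\<in>UNIV. A x z + B y z) \<le> (1::real)"
    and correct: "\<And>x y. x \<in> X \<Longrightarrow> y \<in> Y \<Longrightarrow> 1/2 + d \<le> A x (f x y) + B y (f x y)"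
    and d: "1 / 2 ^ m < 2 * d"
    and k: "CARD('z) \<le> 2 ^ k" "k \<le> 2 ^ l" and two: "2 \<le> CARD('z)"
  shows "oot_solvable X Y (m + (1 + (l + m))) f"
proof -
  obtain code :: "'z \<Rightarrow> nat \<Rightarrow> bool" where code: "\<And>z z'. z \<noteq> z' \<Longrightarrow> \<exists>i<k. code z i \<noteq> code z' i"
    using ex_separating_code[OF k(1)] by metis
  obtain t1 t2 :: "('z \<Rightarrow> real) \<Rightarrow> 'z" where top: "\<And>w. t1 w \<noteq> t2 w" "\<And>w. w (t2 w) \<le> w (t1 w)"
      "\<And>w z. z \<noteq> t1 w \<Longrightarrow> w z \<le> w (t2 w)"
    using ex_top_two[OF two] by metis
  have three: "w (t1 w) + w (t2 w) + w z \<le> sum w UNIV"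
    if "\<And>z. 0 \<le> w z" "z \<noteq> t1 w" "z \<noteq> t2 w" for w z
  proof -
    have "sum w {t1 w, t2 w, z} \<le> sum w UNIV"
      by (rule sum_mono2) (use that in auto)
    then show ?thesis using that top(1)[of w] by simp
  qed
  let ?a = "\<lambda>x. quant m (A x (t1 (A x)))"
  have "oot_solvable {x \<in> X. ?a x = s} Y (1 + (l + m)) f" for s
  proof -
    define X' where "X' = {x \<in> X. ?a x = s}"
    \<comment> \<open>Bob's threshold uses the announced upper bound on \<open>max A\<close>. Alice does not know \<open>max B\<close>, but
      if Bob has three candidates, then hers are among her two heaviest values.\<close>
    define \<theta> where "\<theta> = 1/2 + d - (real s / 2 ^ m + 1 / 2 ^ m)"
    define p where "p y \<longleftrightarrow> (\<forall>z. \<theta> \<le> B y z \<longrightarrow> z = t1 (B y) \<or> z = t2 (B y))" for y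
    have max_A: "A x z \<le> A x (t1 (A x))" for x z
      using top(2)[of "A x"] top(3)[of z "A x"] by (cases "z = t1 (A x)") auto
    have max_B: "B y z \<le> B y (t1 (B y))" for y z
      using top(2)[of "B y"] top(3)[of z "B y"] by (cases "z = t1 (B y)") auto
    have sum: "sum (A x) UNIV + sum (B y) UNIV \<le> 1" if "x \<in> X" "y \<in> Y" for x y
      using total[OF that] by (simp add: sum.distrib)
    have a: "real s / 2 ^ m \<le> A x (t1 (A x))" "A x (t1 (A x)) \<le> real s / 2 ^ m + 1 / 2 ^ m"
      if "x \<in> X'" "y \<in> Y" for x y
    proof -
      have "A x (t1 (A x)) \<le> sum (A x) UNIV" "0 \<le> sum (B y) UNIV"
        using nonneg by (auto intro: member_le_sum sum_nonneg)
      then have "A x (t1 (A x)) \<le> 1" using sum[of x y] that by (simp add: X'_def)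
      from quant_bounds[OF nonneg(1) this, of m] that
      show "real s / 2 ^ m \<le> A x (t1 (A x))" "A x (t1 (A x)) \<le> real s / 2 ^ m + 1 / 2 ^ m"
        by (auto simp: X'_def)
    qed
    have "oot_solvable X' {y \<in> Y. p y = c} (l + m) f" for c
    proof (cases c)
      case True
      show ?thesis
      proof (rule oot_solvable_swap, rule oot_solvable_two_candidates[where A = B and B = A and code = code])
        fix y x assume xy: "y \<in> {y \<in> Y. p y = c}" "x \<in> X'"
        show "(\<Sum>z\<in>UNIV. B y z + A x z) \<le> 1"
          using total[of x y] xy by (simp add: add.commute X'_def)
        show "1/2 + d \<le> B y (f x y) + A x (f x y)"
          using correct[of x y] xy by (simp add: add.commute X'_def)
        \<comment> \<open>Alice's share of the correct value is at most the announced bound on her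
          maximum; at least \<open>\<theta>\<close> is left for Bob.\<close>
        then have "\<theta> \<le> B y (f x y)"
          using a[of x y] max_A[of x "f x y"] xy unfolding \<theta>_def by auto
        then show "f x y = t1 (B y) \<or> f x y = t2 (B y)"
          using xy True p_def by auto
      qed (use nonneg d top(1) code k in auto)
    next
      case False
      show ?thesis
      proof (rule oot_solvable_two_candidates[where A = A and B = B and code = code])
        fix x y assume xy: "y \<in> {y \<in> Y. p y = c}" "x \<in> X'"
        show "(\<Sum>z\<in>UNIV. A x z + B y z) \<le> 1"
          using total[of x y] xy by (simp add: X'_def)
        show *: "1/2 + d \<le> A x (f x y) + B y (f x y)"
          using correct[of x y] xy by (simp add: X'_def)
        obtain z where z: "\<theta> \<le> B y z" "z \<noteq> t1 (B y)" "z \<noteq> t2 (B y)"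
          using xy False p_def by auto
        show "f x y = t1 (A x) \<or> f x y = t2 (A x)"
        proof (rule ccontr)
          assume "\<not> ?thesis"
          then have f: "f x y \<noteq> t1 (A x)" "f x y \<noteq> t2 (A x)" by auto
          \<comment> \<open>Let \<open>M\<close> and \<open>N\<close> be the maxima of
            \<open>A x\<close> and \<open>B y\<close>, so \<open>M + N \<le> 1\<close>. The total
            weight would be at least
            \<open>M + 2 * (1/2 + d - N) + N + 2 * (1/2 + d - M - 1 / 2 ^ m)\<close>, hence at least
            \<open>1 + 4 * d - 2 / 2 ^ m > 1\<close>.\<close>
          have "A x (t1 (A x)) + A x (f x y) + A x (f x y) \<le> sum (A x) UNIV"
            using three[OF nonneg(1) f] top(3)[OF f(1)] by linarith
          moreover have "B y (t1 (B y)) + \<theta> + \<theta> \<le> sum (B y) UNIV"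
            using three[OF nonneg(2) z(2,3)] top(3)[OF z(2)] z(1) by linarith
          moreover have "A x (t1 (A x)) + B y (t1 (B y)) \<le> sum (A x) UNIV + sum (B y) UNIV"
            using nonneg by (intro add_mono member_le_sum) auto
          ultimately show False
            using sum[of x y] xy a[of x y] max_B[of y "f x y"] * d
            unfolding \<theta>_def X'_def by auto
        qed
      qed (use nonneg d top(1) code k in auto)
    qed
    moreover have "finite (p ` Y)" "card (p ` Y) \<le> 2 ^ 1"
      using card_mono[of "UNIV :: bool set" "p ` Y"] finite_subset[of "p ` Y" UNIV] by auto
    ultimately show ?thesis
      unfolding X'_def by (rule oot_solvable_Bob_sends[rotated 2])
  qed
  then show ?thesis by (rule oot_solvable_Alice_sends[OF quant_image])
qed

section \<open>Choice of the precision and the final bounds\<close>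

text \<open>The floor keeps \<open>m\<close> within the claimed cost and worsens the precision by
  less than a factor of \<open>2\<close>, which is the \<open>2\<close> in
  \<open>2 * \<delta> / c\<close>.\<close>

lemma quant_precision:
  fixes c \<delta> :: real
  assumes "0 < c" "0 < \<delta>" "0 \<le> real R + log 2 (c / \<delta>)"
    and "m = nat \<lfloor>real R + log 2 (c / \<delta>)\<rfloor>"
  shows "2 ^ R / 2 ^ m < 2 * \<delta> / c" "real m \<le> real R + log 2 (c / \<delta>)"
proof -
  have m: "real m \<le> real R + log 2 (c / \<delta>)" "real R + log 2 (c / \<delta>) < real m + 1"
    using assms(3,4) by linarith+
  then show "real m \<le> real R + log 2 (c / \<delta>)" by simp
  have "2 ^ R * (c / \<delta>) = 2 powr (real R + log 2 (c / \<delta>))"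
    using assms by (simp add: powr_add powr_realpow)
  also have "\<dots> < 2 powr (real m + 1)" using m by simp
  also have "\<dots> = 2 * 2 ^ m" by (simp add: powr_add powr_realpow)
  finally show "2 ^ R / 2 ^ m < 2 * \<delta> / c"
    using assms by (simp add: field_simps)
qed

theorem mainTheorem17:
  fixes f :: "'x \<Rightarrow> 'y \<Rightarrow> 'z::finite"
    and \<epsilon> :: real and k R :: nat
  assumes "k = nat \<lceil>log 2 (real CARD('z))\<rceil>"
    and "0 < \<epsilon>" and "\<epsilon> < 1/2"
    and "R_oot_priv \<epsilon> f = enat R"
  shows "(\<epsilon> < 1/3 \<longrightarrow>
            ereal_of_enat (D_oot f)
              \<le> ereal (2 ^ (R + 1) * (real R + log 2 (4 / (1/3 - \<epsilon>)) + 1)))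
       \<and> ereal_of_enat (D_oot f)
              \<le> ereal ((2 ^ (R + 1) + 2) * (real R + log 2 (8 / (1/2 - \<epsilon>)) + 1)
                       + log 2 (real k) + 4)"
proof -
  let ?C = "{enat (cost (UNIV \<times> set_pmf \<mu>) (UNIV \<times> set_pmf \<nu>) \<pi>) | \<mu> \<nu> \<pi> outA outB.
            priv_oot_protocol \<epsilon> \<mu> \<nu> \<pi> outA outB f}"
  have "enat R = Inf ?C" using assms(4) by (simp add: R_oot_priv_def)
  moreover have "?C \<noteq> {}"
    using assms(4) unfolding R_oot_priv_def by (metis (lifting) Inf_enat_def enat.distinct(2) infinity_enat_def)
  ultimately have "enat R \<in> ?C"
    by (metis (lifting) Inf_enat_def LeastI all_not_in_conv)
  then obtain \<mu> \<nu> \<pi> outA outB where prot: "priv_oot_protocol \<epsilon> \<mu> \<nu> \<pi> outA outB f"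
      "cost (UNIV \<times> set_pmf \<mu>) (UNIV \<times> set_pmf \<nu>) \<pi> \<le> R"
    by auto
  have bound: "ereal_of_enat (D_oot f) \<le> ereal c" if "oot_solvable UNIV UNIV n f" "real n \<le> c" for n c
  proof -
    have "ereal_of_enat (D_oot f) \<le> ereal_of_enat (enat n)"
      using D_oot_le[OF that(1)] by (simp only: ereal_of_enat_le_iff)
    with that(2) show ?thesis by (simp add: order_trans)
  qed
  have third: "ereal_of_enat (D_oot f) \<le> ereal (2 ^ (R + 1) * (real R + log 2 (4 / (1/3 - \<epsilon>)) + 1))"
    if \<epsilon>: "\<epsilon> < 1/3"
  proof -
    define \<delta> where "\<delta> = 1/3 - \<epsilon>"
    have \<delta>: "0 < \<delta>" "\<delta> < 1/3" using \<epsilon> assms(2) by (auto simp: \<delta>_def)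
    \<comment> \<open>The constant \<open>4\<close> makes the loss
      \<open>2 * (2 ^ R / 2 ^ m)\<close> smaller than \<open>\<delta>\<close>, leaving more than
      \<open>1 - \<epsilon> - \<delta> = 2/3\<close>.\<close>
    define m where "m = nat \<lfloor>real R + log 2 (4 / \<delta>)\<rfloor>"
    have "0 \<le> log 2 (4 / \<delta>)" using \<delta> by simp
    then have m: "2 ^ R / 2 ^ m < 2 * \<delta> / 4" "real m \<le> real R + log 2 (4 / \<delta>)"
      using quant_precision[OF _ \<delta>(1) _ m_def] by auto
    have "oot_solvable UNIV UNIV (m * 2 ^ R + (m * 2 ^ R + 1)) f"
    proof (rule oot_solvable_exchange[OF prot], rule oot_solvable_third)
      fix X Y and A :: "'x \<Rightarrow> 'z \<Rightarrow> real" and B :: "'y \<Rightarrow> 'z \<Rightarrow> real" and x y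
      assume "\<And>x y. x \<in> X \<Longrightarrow> y \<in> Y \<Longrightarrow>
          1 - \<epsilon> - 2 * (2 ^ R / 2 ^ m) \<le> A x (f x y) + B y (f x y)" "x \<in> X" "y \<in> Y"
      then have "1 - \<epsilon> - 2 * (2 ^ R / 2 ^ m) \<le> A x (f x y) + B y (f x y)" by blast
      with m(1) show "2/3 < A x (f x y) + B y (f x y)" by (simp add: \<delta>_def)
    qed
    moreover have "real (m * 2 ^ R + (m * 2 ^ R + 1)) \<le> 2 ^ (R + 1) * (real R + log 2 (4 / \<delta>) + 1)"
    proof -
      have "2 ^ (R + 1) * (real m + 1) \<le> 2 ^ (R + 1) * (real R + log 2 (4 / \<delta>) + 1)"
        using m(2) by (intro mult_left_mono) auto
      moreover have "(1::real) \<le> 2 ^ (R + 1)" by (rule one_le_power) simp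
      ultimately show ?thesis by (simp add: algebra_simps)
    qed
    ultimately show ?thesis unfolding \<delta>_def by (rule bound)
  qed
  have "ereal_of_enat (D_oot f) \<le> ereal ((2 ^ (R + 1) + 2) * (real R + log 2 (8 / (1/2 - \<epsilon>)) + 1)
      + log 2 (real k) + 4)"
  proof -
    define \<delta> where "\<delta> = 1/2 - \<epsilon>"
    have \<delta>: "0 < \<delta>" "\<delta> < 1/2" using assms by (auto simp: \<delta>_def)
    have log: "0 \<le> log 2 (8 / \<delta>)" using \<delta> by simp
    have "ereal_of_enat (D_oot f)
        \<le> ereal ((2 ^ (R + 1) + 2) * (real R + log 2 (8 / \<delta>) + 1) + log 2 (real k) + 4)"
    proof (cases "2 \<le> CARD('z)")
      case False
      then have card: "CARD('z) = 1" using zero_less_card_finite[where 'a = 'z] by linarith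
      then have "f x y = z" for x y z by (metis (full_types) UNIV_I card_1_singletonE singletonD)
      then have "oot_solvable UNIV UNIV 0 f" by (intro oot_solvable_Alice_knows[of _ _ _ "\<lambda>_. undefined"])
      \<comment> \<open>For a single value the bound relies on the default
        \<open>log 2 0 = 0\<close>.\<close>
      moreover have "k = 0" using assms(1) card by simp
      ultimately show ?thesis using log by (intro bound[of 0]) (auto simp: log_def)
    next
      case two: True
      \<comment> \<open>The constant \<open>16\<close> keeps the loss
        \<open>2 * (2 ^ R / 2 ^ m)\<close> below \<open>\<delta> / 4\<close>, leaving the margin
        \<open>3 / 4 * \<delta>\<close>. Against the \<open>8\<close> of the claim it adds
        \<open>1\<close> to the logarithm, which the \<open>+ 1\<close> in the bracket
        covers.\<close>
      define m where "m = nat \<lfloor>real R + log 2 (16 / \<delta>)\<rfloor>"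
      have log16: "log 2 (16 / \<delta>) = log 2 (8 / \<delta>) + 1"
        using \<delta> log_mult[of 2 "8 / \<delta>" 2] by simp
      then have m: "2 ^ R / 2 ^ m < 2 * \<delta> / 16" "real m \<le> real R + log 2 (16 / \<delta>)"
        using quant_precision[OF _ \<delta>(1) _ m_def] log by auto
      have "(1::real) \<le> 2 ^ R" by (rule one_le_power) simp
      then have "1 / 2 ^ m \<le> 2 ^ R / (2::real) ^ m" by (intro divide_right_mono) auto
      then have d: "1 / 2 ^ m < 2 * (3 / 4 * \<delta>)" using m(1) \<delta> by linarith
      define l where "l = nat \<lceil>log 2 (real k)\<rceil>"
      have k: "CARD('z) \<le> 2 ^ k" unfolding assms(1) by (rule ceiling_log2_le_power) simp
      with two have "0 < k" by (cases k) auto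
      then have l: "k \<le> 2 ^ l" unfolding l_def by (rule ceiling_log2_le_power)
      have "0 \<le> log 2 (real k)" using \<open>0 < k\<close> by simp
      then have l': "real l \<le> log 2 (real k) + 1" unfolding l_def by linarith
      have "oot_solvable UNIV UNIV (m * 2 ^ R + (m * 2 ^ R + (m + (1 + (l + m))))) f"
      proof (rule oot_solvable_exchange[OF prot], rule oot_solvable_half[where d = "3 / 4 * \<delta>" and k = k])
        fix X Y and A :: "'x \<Rightarrow> 'z \<Rightarrow> real" and B :: "'y \<Rightarrow> 'z \<Rightarrow> real" and x y
        assume "\<And>x y. x \<in> X \<Longrightarrow> y \<in> Y \<Longrightarrow>
            1 - \<epsilon> - 2 * (2 ^ R / 2 ^ m) \<le> A x (f x y) + B y (f x y)" "x \<in> X" "y \<in> Y"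
        then have "1/2 + \<delta> - 2 * (2 ^ R / 2 ^ m) \<le> A x (f x y) + B y (f x y)"
          by (force simp: \<delta>_def)
        with m(1) show "1/2 + 3 / 4 * \<delta> \<le> A x (f x y) + B y (f x y)" by linarith
      qed (use d k l two in auto)
      moreover have "real (m * 2 ^ R + (m * 2 ^ R + (m + (1 + (l + m)))))
          \<le> (2 ^ (R + 1) + 2) * (real R + log 2 (8 / \<delta>) + 1) + log 2 (real k) + 4"
      proof -
        have "(2 ^ (R + 1) + 2) * real m \<le> (2 ^ (R + 1) + 2) * (real R + log 2 (8 / \<delta>) + 1)"
          using m(2) log16 by (intro mult_left_mono) auto
        with l' show ?thesis by (simp add: algebra_simps)
      qed
      ultimately show ?thesis by (rule bound)
    qed
    then show ?thesis by (simp only: \<delta>_def)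
  qed
  with third show ?thesis by blast
qed

end
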